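(* Let $\alpha,\beta\in\mathbb C$ with $-\alpha,-\beta\notin\mathbb N_0$, let $c,d\in\mathbb C\setminus\{0,1\}$, and let $x,t\in\mathbb C$. Then $$e^t\,{}_1F_1\!\left(\begin{matrix}-x\\ \alpha\end{matrix};\frac{t(1-c)}{c}\right)=\sum_{n=0}^{\infty}\frac{(\beta)_n}{(\alpha)_n\,n!}\,\Phi_2^{(3)}\!\left(-x,x,\alpha-\beta;\alpha+n;\frac{t}{c},\frac{t}{d},t\right)M_n(x;\beta,d)\,t^n.$$
   Context: $\mathbb N_0=\{0,1,2,\dots\}$. Pochhammer symbol: $(a)_n=a(a+1)\cdots(a+n-1)$, $(a)_0=1$. ${}_1F_1\!\left(\begin{matrix}a\\ b\end{matrix};z\right)=\sum_{k\ge0}\frac{(a)_k}{(b)_k}\frac{z^k}{k!}$. Confluent triple Lauricella series: $\Phi_2^{(3)}(b_1,b_2,b_3;c;x,y,z)=\sum_{m,n,p\ge0}\frac{(b_1)_m(b_2)_n(b_3)_p}{(c)_{m+n+p}}\frac{x^m}{m!}\frac{y^n}{n!}\frac{z^p}{p!}$. Meixner polynomials (for $-\beta\notin\mathbb N_0$, $d\ne0$): $M_n(x;\beta,d)={}_2F_1\!\left(\begin{matrix}-n,\,-x\\ \beta\end{matrix};1-\frac1d\right)=\sum_{k=0}^n\frac{(-n)_k(-x)_k}{(\beta)_k\,k!}\left(1-\frac1d\right)^k$. *)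

theory Defs
  imports "HOL-Analysis.Analysis"
begin

definition hyp_1F1 :: "complex \<Rightarrow> complex \<Rightarrow> complex \<Rightarrow> complex" where
  "hyp_1F1 a b z = (\<Sum>k. pochhammer a k / pochhammer b k * (z ^ k / fact k))"

definition hyp_2F1 :: "complex \<Rightarrow> complex \<Rightarrow> complex \<Rightarrow> complex \<Rightarrow> complex" where
  "hyp_2F1 a b c z =
    (\<Sum>k. pochhammer a k * pochhammer b k / pochhammer c k * (z ^ k / fact k))"

text \<open>The triple series is an unordered sum over all triples of natural numbers; it converges
  absolutely for all \<open>x\<close>, \<open>y\<close>, \<open>z\<close> whenever \<open>c\<close> is not a non-positive integer.\<close>

definition Phi2_3 ::
  "complex \<Rightarrow> complex \<Rightarrow> complex \<Rightarrow> complex \<Rightarrow> complex \<Rightarrow> complex \<Rightarrow> complex \<Rightarrow> complex" where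
  "Phi2_3 b1 b2 b3 c x y z =
    (\<Sum>\<^sub>\<infinity>(m, n, p)\<in>UNIV.
      pochhammer b1 m * pochhammer b2 n * pochhammer b3 p / pochhammer c (m + n + p)
        * (x ^ m / fact m) * (y ^ n / fact n) * (z ^ p / fact p))"

definition Meixner :: "nat \<Rightarrow> complex \<Rightarrow> complex \<Rightarrow> complex \<Rightarrow> complex" where
  "Meixner n x \<beta> d = hyp_2F1 (- of_nat n) (- x) \<beta> (1 - 1 / d)"

lemma Meixner_eq_sum:
  "Meixner n x \<beta> d =
    (\<Sum>k\<le>n. pochhammer (- of_nat n) k * pochhammer (- x) k / (pochhammer \<beta> k * fact k)
      * (1 - 1 / d) ^ k)"
  unfolding Meixner_def hyp_2F1_def
  by (subst suminf_finite[of "{..n}"]) (auto simp: pochhammer_of_nat_eq_0_iff)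

end

theory Submission
  imports Defs "HOL-Computational_Algebra.Formal_Power_Series"
begin

text \<open>
  Everything is driven by the generating function
  \[ \sum_n \frac{(\beta)_n}{n!} M_n(x;\beta,d)\, t^n = (1 - t/d)^x (1-t)^{-x-\beta}, \]
  read as an identity of formal power series (\<open>Meixner_generating_function\<close>). With \<open>\<beta>, d\<close>
  replaced by \<open>\<alpha>, c\<close>, its right-hand side factors as
  \[ (1-t/c)^x (1-t)^{-x-\alpha}
     = \bigl[(1-t/d)^x (1-t)^{-x-\beta}\bigr] \cdot (1-t/c)^x (1-t/d)^{-x} (1-t)^{\beta-\alpha}. \]
  The bracket generates \<open>M\<^sub>n(x;\<beta>,d)\<close>; the other three factors have as coefficients the three
  numerator families of \<open>\<Phi>\<^sub>2\<close> with parameters \<open>-x, x, \<alpha>-\<beta>\<close>.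

  The passage from the factorisation to the theorem is the linear map sending \<open>t^N\<close> to
  \<open>t^N/(\<alpha>)\<^sub>N\<close>, that is, division of the \<open>N\<close>-th coefficient by \<open>(\<alpha>)\<^sub>N\<close> followed by summation.
  On the left it gives \<open>\<Sum>N. M\<^sub>N(x;\<alpha>,c) t^N / N!\<close>, which is the Cauchy product of \<open>exp t\<close> with
  the \<open>\<^sub>1F\<^sub>1\<close> series (\<open>exp_times_hyp_1F1_sums_Meixner\<close>). On the right, the splitting
  \<open>(\<alpha>)\<^sub>n\<^sub>+\<^sub>k = (\<alpha>)\<^sub>n (\<alpha>+n)\<^sub>k\<close> turns the fourfold sum into the asserted series of
  \<open>\<Phi>\<^sub>2\<close>-values (\<open>confluent_series_rearrange\<close>). The rearrangement is legitimate because all four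
  factors have geometrically bounded coefficients, whereas \<open>1/(\<alpha>)\<^sub>N\<close> decays faster than any
  geometric sequence.
\<close>

unbundle no vec_syntax and fps_syntax

section \<open>Binomial series\<close>

text \<open>The binomial series \<open>(1 - u X) powr (-a)\<close>.\<close>

definition rising_fps :: "'a::field_char_0 \<Rightarrow> 'a \<Rightarrow> 'a fps" where
  "rising_fps a u = Abs_fps (\<lambda>m. pochhammer a m / fact m * u ^ m)"

lemma rising_fps_nth [simp]: "rising_fps a u $ m = pochhammer a m / fact m * u ^ m"
  by (simp add: rising_fps_def)

text \<open>The Chu--Vandermonde identity, normalised so that it is visibly a convolution.\<close>

lemma pochhammer_convolution:
  fixes a b :: "'a::field_char_0"
  shows "(\<Sum>k\<le>n. pochhammer a k / fact k * (pochhammer b (n - k) / fact (n - k)))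
           = pochhammer (a + b) n / fact n"
proof -
  have "pochhammer (a + b) n / fact n
      = (\<Sum>k\<le>n. of_nat (n choose k) * pochhammer a k * pochhammer b (n - k) / fact n)"
    by (simp add: pochhammer_binomial_sum sum_divide_distrib)
  also have "\<dots> = (\<Sum>k\<le>n. pochhammer a k / fact k * (pochhammer b (n - k) / fact (n - k)))"
    by (intro sum.cong refl) (simp add: binomial_fact)
  finally show ?thesis by simp
qed

lemma rising_fps_mult: "rising_fps a u * rising_fps b u = rising_fps (a + b) u"
proof (rule fps_ext)
  fix n
  have "(rising_fps a u * rising_fps b u) $ n
      = (\<Sum>k\<le>n. pochhammer a k / fact k * (pochhammer b (n - k) / fact (n - k)) * u ^ n)"
    unfolding fps_mult_nth atLeast0AtMost
    by (intro sum.cong refl) (auto simp flip: power_add)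
  also have "\<dots> = rising_fps (a + b) u $ n"
    unfolding sum_distrib_right[symmetric] pochhammer_convolution by simp
  finally show "(rising_fps a u * rising_fps b u) $ n = rising_fps (a + b) u $ n" .
qed

lemma rising_fps_zero_left: "rising_fps 0 u = 1"
  by (rule fps_ext) (auto simp: pochhammer_0_left)

section \<open>Generating function of the Meixner polynomials\<close>

lemma pochhammer_minus_of_nat_div_fact:
  fixes k n :: nat
  assumes "k \<le> n"
  shows "pochhammer (- of_nat n) k / fact n = ((-1) ^ k / fact (n - k) :: 'a::field_char_0)"
proof -
  have "pochhammer (- of_nat n :: 'a) n
      = pochhammer (- of_nat n) k * pochhammer (- of_nat (n - k)) (n - k)"
    using pochhammer_product[OF assms, of "- of_nat n :: 'a"] assms
    by (simp add: of_nat_diff)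
  then have "(-1) ^ n * fact n = pochhammer (- of_nat n) k * ((-1) ^ (n - k) * fact (n - k) :: 'a)"
    by (simp add: pochhammer_same)
  moreover have "(-1 :: 'a) ^ n = (-1) ^ k * (-1) ^ (n - k)"
    using assms by (simp flip: power_add)
  ultimately have "(-1) ^ k * fact n = pochhammer (- of_nat n) k * (fact (n - k) :: 'a)"
    by simp
  then show ?thesis by (simp add: field_simps)
qed

text \<open>
  Reflecting \<open>(b+k)\<^sub>n\<^sub>-\<^sub>k = (-1)^(n-k) (1-b-n)\<^sub>n\<^sub>-\<^sub>k\<close> removes the dependence of the second base on \<open>k\<close>
  and reduces the sum to Chu--Vandermonde; a second reflection brings the result back.
\<close>

lemma alternating_pochhammer_convolution:
  fixes a b :: "'a::field_char_0"
  shows "(\<Sum>k\<le>n. (-1) ^ k * (pochhammer a k / fact k)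
             * (pochhammer (b + of_nat k) (n - k) / fact (n - k)))
           = pochhammer (b - a) n / fact n"
proof -
  have step: "(-1) ^ k * (pochhammer a k / fact k) * (pochhammer (b + of_nat k) (n - k) / fact (n - k))
      = (-1) ^ n * (pochhammer a k / fact k * (pochhammer (1 - b - of_nat n) (n - k) / fact (n - k)))"
    if "k \<le> n" for k
  proof -
    have "pochhammer (b + of_nat k) (n - k)
        = (-1) ^ (n - k) * pochhammer (1 - b - of_nat n) (n - k)"
      using that pochhammer_minus[of "- b - of_nat k" "n - k"]
      by (simp add: of_nat_diff algebra_simps)
    moreover have "(-1 :: 'a) ^ n = (-1) ^ k * (-1) ^ (n - k)"
      using that by (simp flip: power_add)
    ultimately show ?thesis by simp
  qed
  have "(\<Sum>k\<le>n. (-1) ^ k * (pochhammer a k / fact k)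
             * (pochhammer (b + of_nat k) (n - k) / fact (n - k)))
      = (-1) ^ n * (\<Sum>k\<le>n. pochhammer a k / fact k
                       * (pochhammer (1 - b - of_nat n) (n - k) / fact (n - k)))"
    unfolding sum_distrib_left by (intro sum.cong refl step) simp
  also have "\<dots> = (-1) ^ n * pochhammer (a + (1 - b - of_nat n)) n / fact n"
    unfolding pochhammer_convolution by simp
  also have "\<dots> = pochhammer (b - a) n / fact n"
    using pochhammer_minus[of "a - b" n] by (simp add: algebra_simps)
  finally show ?thesis .
qed

text \<open>
  The factors \<open>1/(\<beta>)\<^sub>k\<close> of the Meixner polynomial cancel against \<open>(\<beta>)\<^sub>n\<close>. What is left is the
  \<open>n\<close>-th coefficient of \<open>\<Sum>k. (-x)\<^sub>k/k! (w-1)^k X^k (1-X) powr (-\<beta>-k)\<close> with \<open>w = 1/d\<close>, the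
  expansion of \<open>(1-X) powr (-\<beta>) * (1 - (w-1)X/(1-X)) powr x\<close>.
\<close>

lemma Meixner_eq_sum_shifted:
  assumes "- \<beta> \<notin> \<nat>"
  shows "pochhammer \<beta> n / fact n * Meixner n x \<beta> d
    = (\<Sum>k\<le>n. pochhammer (- x) k / fact k * (1 / d - 1) ^ k
               * (pochhammer (\<beta> + of_nat k) (n - k) / fact (n - k)))"
  unfolding Meixner_eq_sum sum_distrib_left
proof (intro sum.cong refl)
  fix k assume "k \<in> {..n}"
  then have k: "k \<le> n" by simp
  have "pochhammer \<beta> k \<noteq> 0"
    using assms by (auto simp: pochhammer_eq_0_iff)
  moreover have "(1 - 1 / d) ^ k = (-1) ^ k * (1 / d - 1) ^ k"
    by (simp flip: power_mult_distrib)
  ultimately have "pochhammer \<beta> n / fact n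
      * (pochhammer (- of_nat n) k * pochhammer (- x) k / (pochhammer \<beta> k * fact k) * (1 - 1 / d) ^ k)
    = (pochhammer (- of_nat n) k / fact n) * (-1) ^ k
       * (pochhammer (- x) k / fact k * (1 / d - 1) ^ k * pochhammer (\<beta> + of_nat k) (n - k))"
    by (simp add: pochhammer_product[OF k, of \<beta>])
  also have "\<dots> = pochhammer (- x) k / fact k * (1 / d - 1) ^ k
               * (pochhammer (\<beta> + of_nat k) (n - k) / fact (n - k))"
    unfolding pochhammer_minus_of_nat_div_fact[OF k] by (simp flip: power_add)
  finally show "pochhammer \<beta> n / fact n
      * (pochhammer (- of_nat n) k * pochhammer (- x) k / (pochhammer \<beta> k * fact k) * (1 - 1 / d) ^ k)
    = \<dots>" .
qed

text \<open>
  Expanding \<open>(1/d - 1)^k\<close> in powers of \<open>1/d\<close> and exchanging the two sums, the coefficient of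
  \<open>(1/d)^j\<close> is an alternating convolution with bases \<open>-x+j\<close> and \<open>\<beta>+j\<close>; their difference \<open>x+\<beta>\<close>
  does not depend on \<open>j\<close>, which is why the series factors.
\<close>

lemma Meixner_generating_function:
  assumes "- \<beta> \<notin> \<nat>"
  shows "(rising_fps (- x) (t / d) * rising_fps (x + \<beta>) t) $ n
           = pochhammer \<beta> n / fact n * Meixner n x \<beta> d * t ^ n"
proof -
  define g where "g k j = pochhammer (- x) k / fact k
      * (of_nat (k choose j) * (1 / d) ^ j * (-1) ^ (k - j))
      * (pochhammer (\<beta> + of_nat k) (n - k) / fact (n - k))" for k j
  have expand: "(1 / d - 1) ^ k = (\<Sum>j\<le>k. of_nat (k choose j) * (1 / d) ^ j * (-1) ^ (k - j))" for k
    using binomial_ring[of "1 / d" "-1" k] by simp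
  have "pochhammer \<beta> n / fact n * Meixner n x \<beta> d = (\<Sum>k\<le>n. \<Sum>j\<le>k. g k j)"
    unfolding Meixner_eq_sum_shifted[OF assms]
    by (simp only: expand g_def sum_distrib_left sum_distrib_right)
  also have "\<dots> = (\<Sum>j\<le>n. \<Sum>k=j..n. g k j)"
    unfolding sum.Sigma[OF finite_atMost ballI[OF finite_atMost]]
      sum.Sigma[OF finite_atMost ballI[OF finite_atLeastAtMost]]
    by (rule sum.reindex_bij_witness[of _ prod.swap prod.swap]) auto
  also have "\<dots> = (\<Sum>j\<le>n. pochhammer (- x) j / fact j * (1 / d) ^ j
                       * (pochhammer (x + \<beta>) (n - j) / fact (n - j)))"
  proof (intro sum.cong refl)
    fix j assume "j \<in> {..n}"
    then have j: "j \<le> n" by simp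
    have "(\<Sum>k=j..n. g k j) = (\<Sum>i\<le>n - j. g (j + i) j)"
      using j by (intro sum.reindex_bij_witness[of _ "\<lambda>i. j + i" "\<lambda>k. k - j"]) auto
    also have "\<dots> = (\<Sum>i\<le>n - j. pochhammer (- x) j / fact j * (1 / d) ^ j *
        ((-1) ^ i * (pochhammer (- x + of_nat j) i / fact i)
          * (pochhammer (\<beta> + of_nat j + of_nat i) (n - j - i) / fact (n - j - i))))"
    proof (intro sum.cong refl)
      fix i
      have "pochhammer (- x) (j + i) / fact (j + i) * of_nat ((j + i) choose j)
          = pochhammer (- x) j / fact j * (pochhammer (- x + of_nat j) i / fact i)"
        by (simp add: pochhammer_product' binomial_fact)
      then show "g (j + i) j = pochhammer (- x) j / fact j * (1 / d) ^ j *
        ((-1) ^ i * (pochhammer (- x + of_nat j) i / fact i)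
          * (pochhammer (\<beta> + of_nat j + of_nat i) (n - j - i) / fact (n - j - i)))"
        unfolding g_def by (simp add: add.assoc mult_ac)
    qed
    also have "\<dots> = pochhammer (- x) j / fact j * (1 / d) ^ j
                       * (pochhammer (x + \<beta>) (n - j) / fact (n - j))"
      unfolding sum_distrib_left[symmetric] alternating_pochhammer_convolution
      by (simp add: algebra_simps)
    finally show "(\<Sum>k=j..n. g k j) = \<dots>" .
  qed
  finally have "pochhammer \<beta> n / fact n * Meixner n x \<beta> d * t ^ n
      = (\<Sum>j\<le>n. pochhammer (- x) j / fact j * (1 / d) ^ j
                 * (pochhammer (x + \<beta>) (n - j) / fact (n - j)) * t ^ n)"
    by (simp add: sum_distrib_right)
  also have "\<dots> = (\<Sum>j\<le>n. rising_fps (- x) (t / d) $ j * rising_fps (x + \<beta>) t $ (n - j))"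
    by (intro sum.cong refl) (auto simp: power_divide simp flip: power_add)
  finally show ?thesis
    by (simp add: fps_mult_nth atLeast0AtMost)
qed

section \<open>Growth of coefficients\<close>

text \<open>Each quotient \<open>(a+m)/(m+1)\<close> of consecutive terms has norm at most \<open>1 + norm a\<close>.\<close>

lemma norm_pochhammer_div_fact_le:
  "norm (pochhammer a m / fact m) \<le> (1 + norm a) ^ m" for a :: complex
proof (induction m)
  case (Suc m)
  have "norm (a + of_nat m) \<le> norm a + real m"
    by (metis norm_of_nat norm_triangle_ineq)
  also have "\<dots> \<le> (1 + norm a) * (1 + real m)"
    by (simp add: algebra_simps)
  finally have ratio: "norm ((a + of_nat m) / of_nat (Suc m)) \<le> 1 + norm a"
    by (simp add: norm_divide divide_simps del: of_nat_Suc) (simp add: mult_ac)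
  have eq: "pochhammer a (Suc m) / fact (Suc m)
      = pochhammer a m / fact m * ((a + of_nat m) / of_nat (Suc m))"
    by (simp add: pochhammer_Suc)
  show ?case
    unfolding eq norm_mult power_Suc2 using Suc ratio by (intro mult_mono) auto
qed auto

lemma norm_rising_fps_nth_le: "norm (rising_fps a u $ m) \<le> ((1 + norm a) * norm u) ^ m"
  for a u :: complex
  using mult_right_mono[OF norm_pochhammer_div_fact_le[of a m], of "norm u ^ m"]
  by (simp add: norm_mult norm_power norm_divide power_mult_distrib)

text \<open>Inserting binomial coefficients, which are at least one, makes the bound for the convolution
  collapse to a single power, so no polynomial factor in \<open>n\<close> appears.\<close>

lemma norm_fps_mult_nth_le:
  fixes f g :: "complex fps"
  assumes "\<And>n. norm (f $ n) \<le> A ^ n" and "\<And>n. norm (g $ n) \<le> B ^ n"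
    and "A \<ge> 0" and "B \<ge> 0"
  shows "norm ((f * g) $ n) \<le> (A + B) ^ n"
proof -
  have "norm ((f * g) $ n) \<le> (\<Sum>k\<le>n. norm (f $ k) * norm (g $ (n - k)))"
    unfolding fps_mult_nth atLeast0AtMost by (rule sum_norm_le) (simp add: norm_mult)
  also have "\<dots> \<le> (\<Sum>k\<le>n. of_nat (n choose k) * A ^ k * B ^ (n - k))"
  proof (rule sum_mono)
    fix k assume "k \<in> {..n}"
    then have "1 \<le> real (n choose k)"
      by (simp add: Suc_leI)
    have "norm (f $ k) * norm (g $ (n - k)) \<le> A ^ k * B ^ (n - k)"
      using assms by (intro mult_mono) auto
    also have "\<dots> \<le> of_nat (n choose k) * (A ^ k * B ^ (n - k))"
      using \<open>1 \<le> real (n choose k)\<close> assms mult_right_mono[of 1 "real (n choose k)" "A ^ k * B ^ (n - k)"]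
      by simp
    finally show "norm (f $ k) * norm (g $ (n - k)) \<le> of_nat (n choose k) * A ^ k * B ^ (n - k)"
      by (simp add: mult_ac)
  qed
  also have "\<dots> = (A + B) ^ n"
    by (simp add: binomial_ring)
  finally show ?thesis .
qed

text \<open>The terms \<open>r^n/(\<alpha>)\<^sub>n\<close> have ratios \<open>r/(\<alpha>+n)\<close> tending to zero, so they are even summable.\<close>

lemma power_div_pochhammer_bounded:
  fixes \<alpha> :: complex
  assumes "- \<alpha> \<notin> \<nat>"
  obtains K where "\<And>n. r ^ n / norm (pochhammer \<alpha> n) \<le> K"
proof -
  define f where "f n = of_real r ^ n / pochhammer \<alpha> n" for n
  \<comment> \<open>From this index on the ratio \<open>r/(\<alpha>+n)\<close> has norm at most \<open>1/2\<close>.\<close>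
  obtain N :: nat where N: "real N \<ge> 2 * \<bar>r\<bar> + norm \<alpha>"
    using real_arch_simple by blast
  have "summable f"
  proof (rule summable_ratio_test[of "1/2" N])
    fix n assume "N \<le> n"
    then have "2 * \<bar>r\<bar> + norm \<alpha> \<le> real n" using N by linarith
    moreover have "real n \<le> norm (\<alpha> + of_nat n) + norm \<alpha>"
      using norm_triangle_ineq4[of "\<alpha> + of_nat n" \<alpha>] by simp
    ultimately have "2 * \<bar>r\<bar> \<le> norm (\<alpha> + of_nat n)" by linarith
    moreover have "\<alpha> + of_nat n \<noteq> 0"
      using assms by (metis add_eq_0_iff2 of_nat_in_Nats minus_equation_iff add_eq_0_iff)
    ultimately have "norm (of_real r / (\<alpha> + of_nat n)) \<le> 1 / 2"
      by (simp add: norm_divide divide_simps)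
    then have "norm (f n) * norm (of_real r / (\<alpha> + of_nat n)) \<le> norm (f n) * (1 / 2)"
      by (intro mult_left_mono) auto
    then show "norm (f (Suc n)) \<le> 1 / 2 * norm (f n)"
      by (simp add: f_def pochhammer_Suc norm_mult norm_divide norm_power mult_ac)
  qed simp
  then have "Bseq f"
    by (intro convergent_imp_Bseq) (auto dest: summable_LIMSEQ_zero simp: convergent_def)
  then obtain K where K: "\<And>n. norm (f n) \<le> K"
    by (meson BseqE)
  have "r ^ n / norm (pochhammer \<alpha> n) \<le> K" for n
  proof -
    have "r ^ n / norm (pochhammer \<alpha> n) \<le> norm (f n)"
      using abs_ge_self[of "r ^ n"]
      by (simp add: f_def norm_divide norm_power power_abs divide_right_mono)
    with K show ?thesis by (rule order_trans[rotated])
  qed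
  with that show ?thesis by blast
qed

text \<open>Boundedness of \<open>(2R)^n/(\<alpha>)\<^sub>n\<close> turns growth of order \<open>R^n\<close> into decay of order \<open>2^(-n)\<close>.\<close>

lemma norm_div_pochhammer_geometric:
  fixes \<alpha> :: complex
  assumes "- \<alpha> \<notin> \<nat>" and "R \<ge> 0"
  obtains K where "\<And>n z. norm z \<le> R ^ n \<Longrightarrow> norm (z / pochhammer \<alpha> n) \<le> K * (1 / 2) ^ n"
proof -
  obtain K where K: "\<And>n. (2 * R) ^ n / norm (pochhammer \<alpha> n) \<le> K"
    using power_div_pochhammer_bounded[OF assms(1)] by blast
  have "norm (z / pochhammer \<alpha> n) \<le> K * (1 / 2) ^ n" if "norm z \<le> R ^ n" for n z
  proof -
    have "norm (z / pochhammer \<alpha> n) \<le> R ^ n / norm (pochhammer \<alpha> n)"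
      using that by (simp add: norm_divide divide_right_mono)
    also have "\<dots> = (2 * R) ^ n / norm (pochhammer \<alpha> n) * (1 / 2) ^ n"
      by (simp add: power_mult_distrib power_divide)
    also have "\<dots> \<le> K * (1 / 2) ^ n"
      by (intro mult_right_mono K) simp
    finally show ?thesis .
  qed
  with that show ?thesis by blast
qed

section \<open>Rearrangement\<close>

lemma fps_mult4_nth:
  fixes D F G H :: "'a::comm_semiring_0 fps"
  shows "(D * (F * (G * H))) $ N
    = (\<Sum>(n, m, q, p) | n + (m + q + p) = N. D $ n * (F $ m * (G $ q * H $ p)))"
proof -
  have "(D * (F * (G * H))) $ N
    = (\<Sum>(n, m, q)\<in>(SIGMA n:{0..N}. SIGMA m:{0..N - n}. {0..N - n - m}).
         D $ n * (F $ m * (G $ q * H $ (N - n - m - q))))"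
    by (simp add: fps_mult_nth sum_distrib_left sum.Sigma case_prod_unfold)
  also have "\<dots> = (\<Sum>(n, m, q, p) | n + (m + q + p) = N. D $ n * (F $ m * (G $ q * H $ p)))"
    by (rule sum.reindex_bij_witness[of _ "\<lambda>(n, m, q, p). (n, m, q)"
          "\<lambda>(n, m, q). (n, m, q, N - n - m - q)"]) auto
  finally show ?thesis .
qed

lemma summable_on_geometric4:
  "(\<lambda>(n, m, q, p). (1 / 2 :: real) ^ (n + (m + q + p))) summable_on UNIV"
proof -
  have g: "(\<lambda>n. (1 / 2 :: real) ^ n) summable_on UNIV"
    by (rule norm_summable_imp_summable_on) (simp add: summable_geometric)
  have prod: "(\<lambda>(x, y). f x * h y) summable_on UNIV"
    if "f summable_on UNIV" "h summable_on UNIV" "\<And>x. f x \<ge> 0" "\<And>y. h y \<ge> 0"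
    for f :: "nat \<Rightarrow> real" and h :: "'b \<Rightarrow> real"
  proof -
    have "(\<lambda>(x, y). f x * h y) summable_on UNIV \<times> UNIV"
      by (rule summable_on_SigmaI[where g = "\<lambda>x. f x * infsum h UNIV"])
        (use that in \<open>auto intro!: has_sum_cmult_right has_sum_infsum summable_on_cmult_left\<close>)
    then show ?thesis by simp
  qed
  have "(\<lambda>(n, m, q, p). (1 / 2 :: real) ^ n * (case (m, q, p) of (m, q, p) \<Rightarrow> (1 / 2) ^ m *
          (case (q, p) of (q, p) \<Rightarrow> (1 / 2) ^ q * (1 / 2) ^ p))) summable_on UNIV"
    using prod[OF g prod[OF g prod[OF g g]]]
    by (auto simp: case_prod_unfold)
  then show ?thesis
    by (simp add: power_add case_prod_unfold mult_ac)
qed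

text \<open>
  The family \<open>D\<^sub>n F\<^sub>m G\<^sub>q H\<^sub>p / (\<alpha>)\<^sub>N\<close> with \<open>N = n+m+q+p\<close> is absolutely summable over all quadruples.
  Summing it along the finite layers of constant \<open>N\<close> gives the coefficients of the product of the
  four series; summing it first over \<open>(m,q,p)\<close> for each \<open>n\<close> gives the confluent triple series with
  lower parameter \<open>\<alpha>+n\<close>.
\<close>

lemma confluent_series_rearrange:
  fixes D F G H :: "complex fps"
  assumes \<alpha>: "- \<alpha> \<notin> \<nat>" and "R \<ge> 0"
    and D: "\<And>n. norm (D $ n) \<le> R ^ n" and F: "\<And>n. norm (F $ n) \<le> R ^ n"
    and G: "\<And>n. norm (G $ n) \<le> R ^ n" and H: "\<And>n. norm (H $ n) \<le> R ^ n"
    and S: "(\<lambda>N. (D * (F * (G * H))) $ N / pochhammer \<alpha> N) sums S"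
  shows "(\<lambda>n. D $ n / pochhammer \<alpha> n *
      (\<Sum>\<^sub>\<infinity>(m, q, p)\<in>UNIV. F $ m * G $ q * H $ p / pochhammer (\<alpha> + of_nat n) (m + q + p))) sums S"
proof -
  define c where "c n m q p = D $ n * (F $ m * (G $ q * H $ p))" for n m q p
  define f where "f = (\<lambda>(n, m, q, p). c n m q p / pochhammer \<alpha> (n + (m + q + p)))"
  obtain K where K: "\<And>n z. norm z \<le> R ^ n \<Longrightarrow> norm (z / pochhammer \<alpha> n) \<le> K * (1 / 2) ^ n"
    using norm_div_pochhammer_geometric[OF \<alpha> \<open>R \<ge> 0\<close>] by blast
  have "norm (c n m q p) \<le> R ^ (n + (m + q + p))" for n m q p
    unfolding c_def norm_mult power_add mult.assoc
    using \<open>R \<ge> 0\<close> by (intro mult_mono D F G H) auto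
  then have "norm (f z) \<le> K * (case z of (n, m, q, p) \<Rightarrow> (1 / 2) ^ (n + (m + q + p)))" for z
    by (cases z) (auto simp: f_def intro: K)
  then have "(\<lambda>z. norm (f z)) summable_on UNIV"
    by (intro Infinite_Sum.abs_summable_on_comparison_test'[OF summable_on_cmult_right[OF summable_on_geometric4]])
  then have f: "f summable_on UNIV"
    by (rule abs_summable_summable)
  then obtain T where T: "(f has_sum T) UNIV"
    by (auto simp: summable_on_def)

  \<comment> \<open>Summation along the layers of constant total degree.\<close>
  have "(\<lambda>N. (D * (F * (G * H))) $ N / pochhammer \<alpha> N) sums T"
  proof -
    define B where "B N = {(n, m, q, p). n + (m + q + p) = N}" for N :: nat
    have "finite (B N)" for N
      by (rule finite_subset[of _ "{..N} \<times> {..N} \<times> {..N} \<times> {..N}"]) (auto simp: B_def)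
    have "((\<lambda>(N, z). f z) has_sum T) (Sigma UNIV B) \<longleftrightarrow> (f has_sum T) UNIV"
      by (rule has_sum_reindex_bij_witness[of _ "\<lambda>(n, m, q, p). (n + (m + q + p), n, m, q, p)" snd])
        (auto simp: B_def)
    then have "((\<lambda>N. sum f (B N)) has_sum T) UNIV"
      using T has_sum_finite[OF \<open>finite (B _)\<close>, of f]
      by (intro has_sum_SigmaD[where f = "\<lambda>(N, z). f z" and A = UNIV and B = B]) auto
    moreover have "sum f (B N) = (D * (F * (G * H))) $ N / pochhammer \<alpha> N" for N
      unfolding fps_mult4_nth sum_divide_distrib B_def
      by (intro sum.cong refl) (auto simp: f_def c_def)
    ultimately show ?thesis
      by (simp add: has_sum_imp_sums)
  qed
  then have "T = S" using S by (rule sums_unique2)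

  \<comment> \<open>Summation over the triples first.\<close>
  have "((\<lambda>n. \<Sum>\<^sub>\<infinity>z. f (n, z)) has_sum T) UNIV"
  proof (rule has_sum_SigmaD)
    show "(f has_sum T) (UNIV \<times> UNIV)" using T by simp
    show "((\<lambda>z. f (n, z)) has_sum (\<Sum>\<^sub>\<infinity>z. f (n, z))) UNIV" for n
      using summable_on_SigmaD1[of "\<lambda>n z. f (n, z)" UNIV "\<lambda>_. UNIV" n] f
      by (intro has_sum_infsum) auto
  qed
  moreover have "(\<Sum>\<^sub>\<infinity>z. f (n, z)) = D $ n / pochhammer \<alpha> n *
      (\<Sum>\<^sub>\<infinity>(m, q, p)\<in>UNIV. F $ m * G $ q * H $ p / pochhammer (\<alpha> + of_nat n) (m + q + p))" for n
    unfolding infsum_cmult_right'[symmetric]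
    by (intro infsum_cong) (auto simp: f_def c_def pochhammer_product' mult_ac)
  ultimately show ?thesis
    using \<open>T = S\<close> by (simp add: has_sum_imp_sums)
qed

section \<open>The expansion of the confluent hypergeometric function\<close>

text \<open>
  Since \<open>(-N)\<^sub>k/N! = (-1)^k/(N-k)!\<close> and \<open>1 - 1/c = -(1-c)/c\<close>, the terminating sum for
  \<open>M\<^sub>N(x;\<alpha>,c) t^N / N!\<close> is the \<open>N\<close>-th term of the Cauchy product of the two series.
\<close>

lemma exp_times_hyp_1F1_sums_Meixner:
  assumes \<alpha>: "- \<alpha> \<notin> \<nat>" and "c \<noteq> 0"
  shows "(\<lambda>N. Meixner N x \<alpha> c * t ^ N / fact N) sums (exp t * hyp_1F1 (- x) \<alpha> (t * (1 - c) / c))"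
proof -
  define z where "z = t * (1 - c) / c"
  define a where "a k = pochhammer (- x) k / pochhammer \<alpha> k * (z ^ k / fact k)" for k
  have "summable (\<lambda>k. norm (a k))"
  proof -
    have eq: "a k = rising_fps (- x) z $ k / pochhammer \<alpha> k" for k
      by (simp add: a_def)
    obtain K where "\<And>n w. norm w \<le> ((1 + norm (- x)) * norm z) ^ n
        \<Longrightarrow> norm (w / pochhammer \<alpha> n) \<le> K * (1 / 2) ^ n"
      using norm_div_pochhammer_geometric[OF \<alpha>, of "(1 + norm (- x)) * norm z"] by auto
    then have "norm (norm (a k)) \<le> K * (1 / 2) ^ k" for k
      unfolding eq real_norm_def abs_norm_cancel using norm_rising_fps_nth_le by blast
    then show ?thesis
      by (rule summable_comparison_test'[rotated, where N = 0])
        (auto intro!: summable_mult summable_geometric)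
  qed
  from Cauchy_product_sums[OF this summable_norm_exp[of t]]
  have "(\<lambda>N. \<Sum>k\<le>N. a k * (t ^ (N - k) /\<^sub>R fact (N - k))) sums (hyp_1F1 (- x) \<alpha> z * exp t)"
    by (simp add: hyp_1F1_def a_def exp_def)
  moreover have "(\<Sum>k\<le>N. a k * (t ^ (N - k) /\<^sub>R fact (N - k))) = Meixner N x \<alpha> c * t ^ N / fact N" for N
    unfolding Meixner_eq_sum sum_distrib_right sum_divide_distrib
  proof (intro sum.cong refl)
    fix k assume "k \<in> {..N}"
    then have k: "k \<le> N" by simp
    have "z ^ k * t ^ (N - k) = (-1) ^ k * (1 - 1 / c) ^ k * t ^ N"
    proof -
      have "z = (-1) * (1 - 1 / c) * t"
        using \<open>c \<noteq> 0\<close> by (simp add: z_def field_simps)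
      then show ?thesis
        using k by (simp only: power_mult_distrib mult.assoc flip: power_add) simp
    qed
    then have "a k * (t ^ (N - k) /\<^sub>R fact (N - k))
        = pochhammer (- x) k / (pochhammer \<alpha> k * fact k) * (1 - 1 / c) ^ k * t ^ N
          * ((-1) ^ k / fact (N - k))"
      by (simp add: a_def scaleR_conv_of_real field_simps)
    also have "\<dots> = pochhammer (- x) k / (pochhammer \<alpha> k * fact k) * (1 - 1 / c) ^ k * t ^ N
          * (pochhammer (- of_nat N) k / fact N)"
      unfolding pochhammer_minus_of_nat_div_fact[OF k] ..
    finally show "a k * (t ^ (N - k) /\<^sub>R fact (N - k))
        = pochhammer (- of_nat N) k * pochhammer (- x) k / (pochhammer \<alpha> k * fact k)
          * (1 - 1 / c) ^ k * t ^ N / fact N"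
      by (simp add: mult_ac)
  qed
  ultimately show ?thesis
    by (simp add: z_def mult.commute)
qed

theorem theorem10:
  fixes \<alpha> \<beta> c d x t :: complex
  assumes "- \<alpha> \<notin> \<nat>" and "- \<beta> \<notin> \<nat>"
    and "c \<notin> {0, 1}" and "d \<notin> {0, 1}"
  shows "(\<lambda>n. pochhammer \<beta> n / (pochhammer \<alpha> n * fact n)
            * Phi2_3 (- x) x (\<alpha> - \<beta>) (\<alpha> + of_nat n) (t / c) (t / d) t
            * Meixner n x \<beta> d * t ^ n)
          sums (exp t * hyp_1F1 (- x) \<alpha> (t * (1 - c) / c))"
proof -
  define D where "D = rising_fps (- x) (t / d) * rising_fps (x + \<beta>) t"
  define F where "F = rising_fps (- x) (t / c)"
  define G where "G = rising_fps x (t / d)"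
  define H where "H = rising_fps (\<alpha> - \<beta>) t"
  \<comment> \<open>\<open>A a u\<close> is the geometric growth rate of \<open>rising_fps a u\<close>; the sum \<open>R\<close> dominates the rates of
    all four factors, \<open>D\<close> being itself a product of two binomial series.\<close>
  define A where "A a u = (1 + norm a) * norm u" for a u :: complex
  define R where "R = A (- x) (t / d) + A (x + \<beta>) t + A (- x) (t / c) + A x (t / d) + A (\<alpha> - \<beta>) t"
  have A: "A a u \<ge> 0" for a u by (simp add: A_def)
  have rising: "norm (rising_fps a u $ n) \<le> R ^ n" if "A a u \<le> R" for a u n
    using norm_rising_fps_nth_le[of a u n] power_mono[OF that A, of n] by (simp add: A_def)

  have "norm (D $ n) \<le> R ^ n" for n
  proof -
    have "norm (D $ n) \<le> (A (- x) (t / d) + A (x + \<beta>) t) ^ n"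
      unfolding D_def
      by (rule norm_fps_mult_nth_le[OF _ _ A A]) (simp_all only: A_def norm_rising_fps_nth_le)
    also have "\<dots> \<le> R ^ n"
      by (intro power_mono) (auto simp: R_def A)
    finally show ?thesis .
  qed
  moreover have "norm (F $ n) \<le> R ^ n" "norm (G $ n) \<le> R ^ n" "norm (H $ n) \<le> R ^ n" for n
    unfolding F_def G_def H_def by (intro rising; simp add: R_def A)+
  moreover have "(\<lambda>N. (D * (F * (G * H))) $ N / pochhammer \<alpha> N)
      sums (exp t * hyp_1F1 (- x) \<alpha> (t * (1 - c) / c))"
  proof -
    \<comment> \<open>The powers of \<open>1 - t/d\<close> cancel, and \<open>\<beta>\<close> disappears from the exponent of \<open>1 - t\<close>.\<close>
    have "D * (F * (G * H)) = rising_fps (- x) (t / c)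
        * (rising_fps (- x) (t / d) * rising_fps x (t / d))
        * (rising_fps (x + \<beta>) t * rising_fps (\<alpha> - \<beta>) t)"
      by (simp add: D_def F_def G_def H_def mult_ac)
    also have "\<dots> = rising_fps (- x) (t / c) * rising_fps (x + \<alpha>) t"
      by (simp add: rising_fps_mult rising_fps_zero_left)
    finally have "(D * (F * (G * H))) $ N / pochhammer \<alpha> N = Meixner N x \<alpha> c * t ^ N / fact N" for N
      using \<open>- \<alpha> \<notin> \<nat>\<close> by (auto simp: Meixner_generating_function pochhammer_eq_0_iff)
    then show ?thesis
      using exp_times_hyp_1F1_sums_Meixner[OF \<open>- \<alpha> \<notin> \<nat>\<close>, of c x t] \<open>c \<notin> {0, 1}\<close> by simp
  qed
  moreover have "R \<ge> 0" by (simp add: R_def A)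
  ultimately have "(\<lambda>n. D $ n / pochhammer \<alpha> n *
      (\<Sum>\<^sub>\<infinity>(m, q, p)\<in>UNIV. F $ m * G $ q * H $ p / pochhammer (\<alpha> + of_nat n) (m + q + p)))
      sums (exp t * hyp_1F1 (- x) \<alpha> (t * (1 - c) / c))"
    by (intro confluent_series_rearrange[OF \<open>- \<alpha> \<notin> \<nat>\<close>]) auto
  moreover have "(\<Sum>\<^sub>\<infinity>(m, q, p)\<in>UNIV. F $ m * G $ q * H $ p / pochhammer (\<alpha> + of_nat n) (m + q + p))
      = Phi2_3 (- x) x (\<alpha> - \<beta>) (\<alpha> + of_nat n) (t / c) (t / d) t" for n
    unfolding Phi2_3_def
    by (intro infsum_cong) (auto simp: F_def G_def H_def mult_ac)
  moreover have "D $ n = pochhammer \<beta> n / fact n * Meixner n x \<beta> d * t ^ n" for n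
    unfolding D_def by (rule Meixner_generating_function) fact
  ultimately show ?thesis
    by (simp add: mult_ac)
qed

end
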